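(* Let $V\subset\mathbb{R}^n$ be an open convex regular cone such that the Siegel domain of the first kind $V\oplus\sqrt{-1}\,\mathbb{R}^n\subset\mathbb{C}^n$ is homogeneous. Then $V\oplus\sqrt{-1}\,\mathbb{R}^n$ admits a homogeneous conformally Kähler structure.
   Context: A set $V\subset\mathbb{R}^n$ is a cone if $ax\in V$ for all $x\in V$ and $a>0$; a cone is regular if it contains no full straight line. A Siegel domain of the first kind is a complex domain $V\oplus\sqrt{-1}\,\mathbb{R}^n=\{x+\sqrt{-1}\,y: x\in V,\ y\in\mathbb{R}^n\}$ with $V$ an open convex regular cone. Homogeneity of the domain is with respect to its complex affine automorphisms $x+\sqrt{-1}\,y\mapsto Ax+\sqrt{-1}(Ay+b)$, where $A$ is a linear automorphism of $V$ and $b\in\mathbb{R}^n$; it is homogeneous if and only if $V$ is homogeneous, i.e. the group $\mathrm{Aut}(V)$ of linear automorphisms of $V$ acts transitively on $V$. A (globally) conformally Kähler structure on a manifold $N$ is a pair $(I,f\omega)$, where $(I,\omega)$ is a Kähler structure on $N$ and $f$ is a positive function on $N$; here $I$ is the standard complex structure of the domain. It is homogeneous if there is a group acting transitively on $N$ by diffeomorphisms that preserve $I$ and $f\omega$. *)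

theory Defs
  imports "HOL-Analysis.Analysis" "HOL-Algebra.Group_Action"
begin

section \<open>Regular cones and Siegel domains of the first kind\<close>

text \<open>The library constant \<open>cone\<close> closes under all scalars \<open>c \<ge> 0\<close> and so forces the
  origin into every nonempty cone; here only positive scalars are allowed, as is needed for open
  cones.\<close>

definition is_cone :: "(real ^ 'n) set \<Rightarrow> bool" where
  "is_cone V \<longleftrightarrow> (\<forall>x\<in>V. \<forall>a>0. a *\<^sub>R x \<in> V)"

definition contains_line :: "(real ^ 'n) set \<Rightarrow> bool" where
  "contains_line V \<longleftrightarrow> (\<exists>p v. v \<noteq> 0 \<and> (\<forall>t. p + t *\<^sub>R v \<in> V))"

definition regular_cone :: "(real ^ 'n) set \<Rightarrow> bool" where
  "regular_cone V \<longleftrightarrow> is_cone V \<and> \<not> contains_line V"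

definition cvec :: "real ^ 'n \<Rightarrow> real ^ 'n \<Rightarrow> complex ^ 'n" where
  "cvec x y = (\<chi> i. Complex (x $ i) (y $ i))"

definition siegel_domain :: "(real ^ 'n) set \<Rightarrow> (complex ^ 'n) set" where
  "siegel_domain V = {cvec x y | x y. x \<in> V}"

definition linear_automorphism :: "(real ^ 'n) set \<Rightarrow> (real ^ 'n \<Rightarrow> real ^ 'n) \<Rightarrow> bool" where
  "linear_automorphism V A \<longleftrightarrow> linear A \<and> bij A \<and> A ` V = V"

definition siegel_affine_automorphisms ::
  "(real ^ 'n) set \<Rightarrow> (complex ^ 'n \<Rightarrow> complex ^ 'n) set" where
  "siegel_affine_automorphisms V =
     {F. \<exists>A b. linear_automorphism V A \<and> (\<forall>x y. F (cvec x y) = cvec (A x) (A y + b))}"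

definition homogeneous_siegel_domain :: "(real ^ 'n) set \<Rightarrow> bool" where
  "homogeneous_siegel_domain V \<longleftrightarrow>
     (\<forall>z\<in>siegel_domain V. \<forall>w\<in>siegel_domain V. \<exists>F\<in>siegel_affine_automorphisms V. F z = w)"


section \<open>Smooth maps on open sets\<close>

text \<open>Intended for open \<open>S\<close> only: all derivatives are full Frechet derivatives at points of
  \<open>S\<close>, which for open \<open>S\<close> depend only on \<open>f\<close> restricted to \<open>S\<close>.\<close>

primrec Ck_on ::
  "nat \<Rightarrow> 'a::euclidean_space set \<Rightarrow> ('a \<Rightarrow> 'b::euclidean_space) \<Rightarrow> bool" where
  "Ck_on 0 S f \<longleftrightarrow> continuous_on S f"
| "Ck_on (Suc k) S f \<longleftrightarrow>
     (\<forall>x\<in>S. f differentiable (at x)) \<and> (\<forall>v. Ck_on k S (\<lambda>x. frechet_derivative f (at x) v))"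

definition smooth_on :: "'a::euclidean_space set \<Rightarrow> ('a \<Rightarrow> 'b::euclidean_space) \<Rightarrow> bool" where
  "smooth_on S f \<longleftrightarrow> (\<forall>k. Ck_on k S f)"

definition diffeomorphism_on :: "'a::euclidean_space set \<Rightarrow> ('a \<Rightarrow> 'a) \<Rightarrow> bool" where
  "diffeomorphism_on S F \<longleftrightarrow> bij_betw F S S \<and> smooth_on S F \<and> smooth_on S (inv_into S F)"


section \<open>Kaehler and conformally Kaehler structures on domains in complex space\<close>

text \<open>A real 2-form on an open set \<open>U\<close> is a function \<open>\<omega> z u v\<close> of a point and two real tangent
  vectors; its values at points outside \<open>U\<close> are irrelevant.\<close>

type_synonym 'n form2 = "complex ^ 'n \<Rightarrow> complex ^ 'n \<Rightarrow> complex ^ 'n \<Rightarrow> real"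

definition std_complex_structure :: "complex ^ 'n \<Rightarrow> complex ^ 'n" where
  "std_complex_structure v = \<i> *s v"

definition smooth_2form_on :: "(complex ^ 'n) set \<Rightarrow> 'n form2 \<Rightarrow> bool" where
  "smooth_2form_on U \<omega> \<longleftrightarrow>
     (\<forall>z\<in>U. bilinear (\<omega> z) \<and> (\<forall>v. \<omega> z v v = 0)) \<and>
     (\<forall>u v. smooth_on U (\<lambda>z. \<omega> z u v))"

text \<open>The usual formula for \<open>d\<omega>\<close> evaluated on constant, hence commuting, vector fields.\<close>

definition ext_deriv2 ::
  "'n form2 \<Rightarrow> complex ^ 'n \<Rightarrow> complex ^ 'n \<Rightarrow> complex ^ 'n \<Rightarrow> complex ^ 'n \<Rightarrow> real" where
  "ext_deriv2 \<omega> z u v w =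
     frechet_derivative (\<lambda>p. \<omega> p v w) (at z) u
     + frechet_derivative (\<lambda>p. \<omega> p w u) (at z) v
     + frechet_derivative (\<lambda>p. \<omega> p u v) (at z) w"

text \<open>\<open>(I, \<omega>)\<close> is a Kaehler structure on \<open>U\<close>, with \<open>I\<close> the standard (integrable) complex
  structure: \<open>\<omega>\<close> is closed, \<open>I\<close>-invariant, and \<open>g(u, v) = \<omega>(u, I v)\<close> is a Riemannian metric.\<close>

definition kaehler_on :: "(complex ^ 'n) set \<Rightarrow> 'n form2 \<Rightarrow> bool" where
  "kaehler_on U \<omega> \<longleftrightarrow>
     smooth_2form_on U \<omega> \<and>
     (\<forall>z\<in>U. \<forall>u v w. ext_deriv2 \<omega> z u v w = 0) \<and>
     (\<forall>z\<in>U. \<forall>u v. \<omega> z (std_complex_structure u) (std_complex_structure v) = \<omega> z u v) \<and>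
     (\<forall>z\<in>U. \<forall>u. u \<noteq> 0 \<longrightarrow> \<omega> z u (std_complex_structure u) > 0)"

definition conformally_kaehler_on :: "(complex ^ 'n) set \<Rightarrow> 'n form2 \<Rightarrow> bool" where
  "conformally_kaehler_on U \<eta> \<longleftrightarrow>
     (\<exists>f \<omega>. kaehler_on U \<omega> \<and> smooth_on U f \<and> (\<forall>z\<in>U. f z > 0) \<and>
        (\<forall>z\<in>U. \<forall>u v. \<eta> z u v = f z * \<omega> z u v))"

definition preserves_complex_structure_on ::
  "(complex ^ 'n) set \<Rightarrow> (complex ^ 'n \<Rightarrow> complex ^ 'n) \<Rightarrow> bool" where
  "preserves_complex_structure_on U F \<longleftrightarrow>
     (\<forall>z\<in>U. \<forall>v. frechet_derivative F (at z) (std_complex_structure v)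
                  = std_complex_structure (frechet_derivative F (at z) v))"

definition preserves_2form_on ::
  "(complex ^ 'n) set \<Rightarrow> 'n form2 \<Rightarrow> (complex ^ 'n \<Rightarrow> complex ^ 'n) \<Rightarrow> bool" where
  "preserves_2form_on U \<eta> F \<longleftrightarrow>
     (\<forall>z\<in>U. \<forall>u v. \<eta> (F z) (frechet_derivative F (at z) u) (frechet_derivative F (at z) v)
                    = \<eta> z u v)"

text \<open>Taking the elements of the acting group in the type of self-maps of the ambient space loses
  nothing: an abstract group may be replaced by its image in the group of bijections of \<open>U\<close>.\<close>

definition homogeneous_on :: "(complex ^ 'n) set \<Rightarrow> 'n form2 \<Rightarrow> bool" where
  "homogeneous_on U \<eta> \<longleftrightarrow>
     (\<exists>(G :: (complex ^ 'n \<Rightarrow> complex ^ 'n) monoid) \<phi>.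
        transitive_action G U \<phi> \<and>
        (\<forall>g\<in>carrier G. diffeomorphism_on U (\<phi> g) \<and>
           preserves_complex_structure_on U (\<phi> g) \<and> preserves_2form_on U \<eta> (\<phi> g)))"

end

theory Submission
  imports Defs
begin

text \<open>With \<open>V\<^sup>*\<close> the dual cone, the Laplace transform \<open>\<psi>(x) = \<integral>\<^sub>V\<^sub>* exp(- \<langle>x, \<xi>\<rangle>) d\<xi>\<close> is smooth and
  has Hessian \<open>(a, b) \<mapsto> \<integral>\<^sub>V\<^sub>* \<langle>a, \<xi>\<rangle> \<langle>b, \<xi>\<rangle> exp(- \<langle>x, \<xi>\<rangle>) d\<xi>\<close>, positive definite because the dual of a
  regular cone has interior. Hence \<open>\<psi>(Re z)\<close> is the potential of a Kaehler form \<open>\<omega>\<close>. A linear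
  automorphism \<open>A\<close> of \<open>V\<close> multiplies \<open>\<psi>\<close>, and with it \<open>\<omega>\<close>, by a positive constant, and translations
  along the imaginary directions preserve both. So \<open>\<psi>\<^sup>-\<^sup>1 \<omega>\<close> is invariant under the transitive group
  of affine automorphisms.\<close>

section \<open>Calculus of \<open>C\<^sup>k\<close> functions\<close>

text \<open>Near a point of the open set \<open>S\<close> the two functions agree, so they have the
  same derivative there; the induction runs over all pairs \<open>f\<close>,
  \<open>g\<close>.\<close>

lemma Ck_on_cong:
  assumes "open S" "\<And>x. x \<in> S \<Longrightarrow> f x = g x" "Ck_on k S f"
  shows "Ck_on k S g"
  using assms(2,3)
proof (induction k arbitrary: f g)
  case 0
  then show ?case
    by (simp cong: continuous_on_cong)
next
  case (Suc k)
  have d: "(g has_derivative frechet_derivative f (at x)) (at x)" if "x \<in> S" for x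
  proof (rule has_derivative_transform_within_open [OF _ \<open>open S\<close> that])
    show "(f has_derivative frechet_derivative f (at x)) (at x)"
      using Suc.prems(2) that by (simp add: frechet_derivative_works)
  qed (simp add: Suc.prems(1))
  have "Ck_on k S (\<lambda>x. frechet_derivative g (at x) v)" for v
  proof (rule Suc.IH)
    show "Ck_on k S (\<lambda>x. frechet_derivative f (at x) v)"
      using Suc.prems(2) by simp
  qed (simp add: frechet_derivative_at [OF d])
  moreover have "\<forall>x\<in>S. g differentiable (at x)"
    using d differentiableI by blast
  ultimately show ?case
    by simp
qed

text \<open>Trades the choice term \<open>frechet_derivative\<close> in \<open>Ck_on\<close> for
  whatever explicit derivative \<open>f'\<close> is at hand.\<close>

lemma Ck_on_SucI:
  assumes "open S" "\<And>x. x \<in> S \<Longrightarrow> (f has_derivative f' x) (at x)"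
    and "\<And>v. Ck_on k S (\<lambda>x. f' x v)"
  shows "Ck_on (Suc k) S f"
proof -
  have "Ck_on k S (\<lambda>x. frechet_derivative f (at x) v)" for v
    by (rule Ck_on_cong [OF \<open>open S\<close> _ assms(3)])
      (simp flip: frechet_derivative_at [OF assms(2)])
  then show ?thesis
    using differentiableI [OF assms(2)] by simp
qed

lemma Ck_on_SucD: "Ck_on (Suc k) S f \<Longrightarrow> Ck_on k S f"
proof (induction k arbitrary: f)
  case 0
  then show ?case
    by (auto intro!: continuous_at_imp_continuous_on differentiable_imp_continuous_within)
next
  case (Suc k)
  then show ?case
    by (metis Ck_on.simps(2))
qed

lemma Ck_on_SucE:
  assumes "Ck_on (Suc k) S f"
  shows "\<And>x. x \<in> S \<Longrightarrow> (f has_derivative frechet_derivative f (at x)) (at x)"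
    and "Ck_on k S (\<lambda>x. frechet_derivative f (at x) v)"
  using assms by (simp_all add: frechet_derivative_works)

lemma Ck_on_const: "open S \<Longrightarrow> Ck_on k S (\<lambda>x. c)"
proof (induction k arbitrary: c)
  case (Suc k)
  show ?case
    by (rule Ck_on_SucI [where f' = "\<lambda>x v. 0"]) (use Suc in auto)
qed auto

lemma smooth_on_affine:
  fixes L :: "'a::euclidean_space \<Rightarrow> 'b::euclidean_space"
  assumes "open S" "linear L" "\<And>x. x \<in> S \<Longrightarrow> f x = L x + c"
  shows "smooth_on S f"
  unfolding smooth_on_def
proof
  have d: "((\<lambda>x. L x + c) has_derivative L) (at x)" for x
    using assms(2) by (auto intro!: derivative_eq_intros linear_imp_has_derivative)
  show "Ck_on k S f" for k
  proof (rule Ck_on_cong [OF \<open>open S\<close>])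
    show "Ck_on k S (\<lambda>x. L x + c)"
    \<comment> \<open>Going one order up avoids a case split on \<open>k\<close>: the directional
      derivatives of an affine map are constants.\<close>
    proof (rule Ck_on_SucD [OF Ck_on_SucI [OF \<open>open S\<close> d]])
      show "Ck_on k S (\<lambda>x. L v)" for v
        by (rule Ck_on_const [OF \<open>open S\<close>])
    qed
  qed (simp add: assms(3))
qed

lemma Ck_on_add:
  assumes "open S" "Ck_on k S f" "Ck_on k S g"
  shows "Ck_on k S (\<lambda>x. f x + g x)"
  using assms(2,3)
proof (induction k arbitrary: f g)
  case 0
  then show ?case
    by (simp add: continuous_on_add)
next
  case (Suc k)
  note f = Ck_on_SucE [OF Suc.prems(1)] and g = Ck_on_SucE [OF Suc.prems(2)]
  show ?case
    by (rule Ck_on_SucI [OF \<open>open S\<close> has_derivative_add [OF f(1) g(1)] Suc.IH [OF f(2) g(2)]])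
qed

lemma Ck_on_mult:
  fixes f g :: "'a::euclidean_space \<Rightarrow> real"
  assumes "open S" "Ck_on k S f" "Ck_on k S g"
  shows "Ck_on k S (\<lambda>x. f x * g x)"
  using assms(2,3)
proof (induction k arbitrary: f g)
  case 0
  then show ?case
    by (simp add: continuous_on_mult)
next
  case (Suc k)
  note f = Ck_on_SucE [OF Suc.prems(1)] and g = Ck_on_SucE [OF Suc.prems(2)]
  \<comment> \<open>The product rule pairs each function with the derivative of the other, so the
    functions themselves are lowered from order \<open>Suc k\<close> to \<open>k\<close>.\<close>
  show ?case
    by (rule Ck_on_SucI [OF \<open>open S\<close> has_derivative_mult [OF f(1) g(1)]])
      (use Suc.IH Ck_on_SucD [OF Suc.prems(1)] Ck_on_SucD [OF Suc.prems(2)] f(2) g(2)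
        Ck_on_add [OF \<open>open S\<close>] in blast)+
qed

lemma Ck_on_uminus:
  fixes f :: "'a::euclidean_space \<Rightarrow> real"
  assumes "open S" "Ck_on k S f"
  shows "Ck_on k S (\<lambda>x. - f x)"
  using Ck_on_mult [OF assms(1) Ck_on_const [OF assms(1), of k "-1"] assms(2)] by simp

text \<open>The derivative of \<open>1 / f\<close> is built from \<open>1 / f\<close> and the
  derivative of \<open>f\<close> by products, so the induction feeds on itself with \<open>f\<close>
  fixed.\<close>

lemma Ck_on_inverse:
  fixes f :: "'a::euclidean_space \<Rightarrow> real"
  assumes "open S" "Ck_on k S f" "\<And>x. x \<in> S \<Longrightarrow> f x \<noteq> 0"
  shows "Ck_on k S (\<lambda>x. inverse (f x))"
  using assms(2)
proof (induction k)
  case 0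
  then show ?case
    by (simp add: assms(3) continuous_on_inverse)
next
  case (Suc k)
  note f = Ck_on_SucE [OF Suc.prems]
  have i: "Ck_on k S (\<lambda>x. inverse (f x))"
    by (rule Suc.IH [OF Ck_on_SucD [OF Suc.prems]])
  show ?case
  proof (rule Ck_on_SucI [OF \<open>open S\<close>])
    show "((\<lambda>x. inverse (f x)) has_derivative
        (\<lambda>h. - (inverse (f x) * frechet_derivative f (at x) h * inverse (f x)))) (at x)"
      if "x \<in> S" for x
      by (rule Deriv.has_derivative_inverse [OF assms(3) f(1)]) (use that in auto)
    show "Ck_on k S (\<lambda>x. - (inverse (f x) * frechet_derivative f (at x) v * inverse (f x)))" for v
      by (intro Ck_on_uminus Ck_on_mult \<open>open S\<close> i f(2))
  qed
qed

section \<open>Laplace transforms over the dual cone\<close>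

text \<open>Second-order remainder for differentiating under the integral. It rests on
  \<open>exp s - 1 \<le> s * exp s\<close>, a form of \<open>1 - s \<le> exp (-s)\<close>, and on
  \<open>1 + t \<le> exp t\<close>.\<close>

lemma abs_exp_minus_le:
  fixes t :: real
  shows "\<bar>exp t - 1 - t\<bar> \<le> t\<^sup>2 * exp \<bar>t\<bar>"
proof -
  have a: "exp s - 1 \<le> s * exp s" for s :: real
  proof -
    have "(1 - s) * exp s \<le> exp (-s) * exp s"
      using exp_ge_add_one_self [of "-s"] by (intro mult_right_mono) auto
    then show ?thesis
      by (simp add: algebra_simps flip: exp_add)
  qed
  have "exp t - 1 - t \<le> t * (exp t - 1)"
    using a [of t] by (simp add: algebra_simps)
  also have "\<dots> \<le> t\<^sup>2 * exp \<bar>t\<bar>"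
  proof (cases "t \<ge> 0")
    case True
    then show ?thesis
      using mult_left_mono [OF a [of t] True] by (simp add: power2_eq_square mult.assoc)
  next
    case False
    then have "t * (exp t - 1) \<le> t * t"
      using exp_ge_add_one_self [of t] by (intro mult_left_mono_neg) (linarith, simp)
    also have "\<dots> \<le> t\<^sup>2 * exp \<bar>t\<bar>"
      by (simp add: power2_eq_square mult_le_cancel_left1)
    finally show ?thesis .
  qed
  finally show ?thesis
    using exp_ge_add_one_self [of t] by linarith
qed

section \<open>Integrability of exponential decay\<close>

lemma nn_integral_exp_abs_finite:
  fixes c :: real
  assumes "c > 0"
  shows "(\<integral>\<^sup>+t. ennreal (exp (- c * \<bar>t\<bar>)) \<partial>lborel) < \<infinity>"
proof -
  let ?h = "\<lambda>t::real. ennreal (exp (- c * t)) * indicator {0..} t"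
  have "(\<integral>\<^sup>+t. ?h t \<partial>lborel) = ennreal (0 - (- exp (- c * 0) / c))"
  proof (rule nn_integral_FTC_atLeast)
    show "((\<lambda>t. - exp (- c * t) / c) has_real_derivative exp (- c * t)) (at t)" for t
      using assms by (auto intro!: derivative_eq_intros)
    show "((\<lambda>t. - exp (- c * t) / c) \<longlongrightarrow> 0) at_top"
    proof -
      have "filterlim (\<lambda>t. - c * t) at_bot at_top"
        using assms
        by (intro filterlim_tendsto_neg_mult_at_bot [OF tendsto_const] filterlim_ident) auto
      then have "((\<lambda>t. exp (- c * t)) \<longlongrightarrow> 0) at_top"
        by (rule filterlim_compose [OF exp_at_bot])
      from tendsto_mult_right_zero [OF this, of "- 1 / c"]
      show ?thesis by simp
    qed
  qed auto
  then have fin: "(\<integral>\<^sup>+t. ?h t \<partial>lborel) < \<infinity>"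
    by simp
  \<comment> \<open>Reflection moves the explicit half-line integral to the negative
    half-line.\<close>
  have refl: "(\<integral>\<^sup>+t. ?h t \<partial>lborel) = (\<integral>\<^sup>+t. ?h (- t) \<partial>lborel)"
    by (subst nn_integral_real_affine [where c = "-1" and t = 0]) auto
  have "(\<integral>\<^sup>+t. ennreal (exp (- c * \<bar>t\<bar>)) \<partial>lborel) \<le> (\<integral>\<^sup>+t. ?h t + ?h (- t) \<partial>lborel)"
    by (intro nn_integral_mono) (auto simp: indicator_def)
  also have "\<dots> = (\<integral>\<^sup>+t. ?h t \<partial>lborel) + (\<integral>\<^sup>+t. ?h (- t) \<partial>lborel)"
    by (rule nn_integral_add) auto
  also have "\<dots> < \<infinity>"
    using fin refl by simp
  finally show ?thesis .
qed

lemma integrable_exp_norm: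
  assumes "e > 0"
  shows "integrable lborel (\<lambda>\<xi>::'a::euclidean_space. exp (- e * norm \<xi>))"
proof (rule integrableI_bounded)
  \<comment> \<open>Each of the \<open>DIM('a)\<close> coordinates is at most the norm in absolute
    value, so this rate bounds \<open>exp (- e * norm \<xi>)\<close> by a product of one-dimensional
    factors.\<close>
  define c where "c = e / DIM('a)"
  have "c > 0"
    using assms by (simp add: c_def)
  have le: "exp (- e * norm \<xi>) \<le> (\<Prod>b\<in>Basis. exp (- c * \<bar>\<xi> \<bullet> b\<bar>))" for \<xi> :: 'a
  proof -
    have "(\<Sum>b\<in>Basis. \<bar>\<xi> \<bullet> b\<bar>) \<le> (\<Sum>b\<in>(Basis::'a set). norm \<xi>)"
      by (intro sum_mono) (simp add: Basis_le_norm)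
    then have "c * (\<Sum>b\<in>Basis. \<bar>\<xi> \<bullet> b\<bar>) \<le> c * (DIM('a) * norm \<xi>)"
      using \<open>c > 0\<close> by (intro mult_left_mono) auto
    also have "\<dots> = e * norm \<xi>"
      by (simp add: c_def)
    finally show ?thesis
      by (simp add: sum_distrib_left sum_negf flip: exp_sum)
  qed
  have "(\<integral>\<^sup>+\<xi>. ennreal (norm (exp (- e * norm (\<xi>::'a)))) \<partial>lborel)
      \<le> (\<integral>\<^sup>+\<xi>. (\<Prod>b\<in>Basis. ennreal (exp (- c * \<bar>(\<xi>::'a) \<bullet> b\<bar>))) \<partial>lborel)"
    using le by (intro nn_integral_mono) (simp add: prod_ennreal ennreal_leI)
  also have "\<dots> = (\<Prod>b\<in>(Basis::'a set). (\<integral>\<^sup>+t. ennreal (exp (- c * \<bar>t\<bar>)) \<partial>lborel))"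
    by (rule nn_integral_lborel_prod) auto
  also have "\<dots> < \<infinity>"
    using nn_integral_exp_abs_finite [OF \<open>c > 0\<close>] by (simp add: power_less_top_ennreal)
  finally show "(\<integral>\<^sup>+\<xi>. ennreal (norm (exp (- e * norm (\<xi>::'a)))) \<partial>lborel) < \<infinity>" .
qed auto

text \<open>The admissible weights of a Laplace integral: any exponential decay on the dual cone
  absorbs them, and the class survives the multiplication by linear forms that differentiation
  causes.\<close>

definition subexponential :: "('a::euclidean_space \<Rightarrow> real) \<Rightarrow> bool" where
  "subexponential p \<longleftrightarrow>
     p \<in> borel_measurable borel \<and> (\<forall>e>0. \<exists>C. \<forall>\<xi>. \<bar>p \<xi>\<bar> \<le> C * exp (e * norm \<xi>))"

lemma subexponential_measurable [measurable_dest]: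
  "subexponential p \<Longrightarrow> p \<in> borel_measurable borel"
  by (simp add: subexponential_def)

lemma subexponential_bound:
  assumes "subexponential p" "e > 0"
  obtains C where "\<And>\<xi>. \<bar>p \<xi>\<bar> \<le> C * exp (e * norm \<xi>)"
  using assms unfolding subexponential_def by blast

lemma subexponential_const: "subexponential (\<lambda>\<xi>. c)"
  unfolding subexponential_def
proof (intro conjI allI impI exI)
  fix e :: real and \<xi> :: 'a
  assume "e > 0"
  then show "\<bar>c\<bar> \<le> \<bar>c\<bar> * exp (e * norm \<xi>)"
    by (simp add: mult_le_cancel_left1)
qed auto

lemma subexponential_mult:
  assumes "subexponential p" "subexponential q"
  shows "subexponential (\<lambda>\<xi>. p \<xi> * q \<xi>)"
  unfolding subexponential_def
proof (intro conjI allI impI)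
  show "(\<lambda>\<xi>. p \<xi> * q \<xi>) \<in> borel_measurable borel"
    using assms by measurable
  fix e :: real
  assume "e > 0"
  obtain C where C: "\<And>\<xi>. \<bar>p \<xi>\<bar> \<le> C * exp (e / 2 * norm \<xi>)"
    using subexponential_bound [OF assms(1), of "e / 2"] \<open>e > 0\<close> by auto
  obtain C' where C': "\<And>\<xi>. \<bar>q \<xi>\<bar> \<le> C' * exp (e / 2 * norm \<xi>)"
    using subexponential_bound [OF assms(2), of "e / 2"] \<open>e > 0\<close> by auto
  have "\<bar>p \<xi> * q \<xi>\<bar> \<le> (C * C') * exp (e * norm \<xi>)" for \<xi>
  proof -
    have "\<bar>p \<xi> * q \<xi>\<bar> \<le> (C * exp (e / 2 * norm \<xi>)) * (C' * exp (e / 2 * norm \<xi>))"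
      unfolding abs_mult using C [of \<xi>] C' [of \<xi>]
      by (intro mult_mono) (auto intro: order_trans [OF abs_ge_zero])
    also have "\<dots> = (C * C') * exp (e * norm \<xi>)"
      by (simp add: algebra_simps flip: exp_add)
    finally show ?thesis .
  qed
  then show "\<exists>C. \<forall>\<xi>. \<bar>p \<xi> * q \<xi>\<bar> \<le> C * exp (e * norm \<xi>)"
    by blast
qed

text \<open>Apply \<open>t \<le> exp t\<close> at \<open>t = e * norm \<xi>\<close>; the constant
  becomes \<open>\<bar>B\<bar> / e\<close>.\<close>

lemma subexponential_linear_growth:
  assumes "p \<in> borel_measurable borel" "\<And>\<xi>. \<bar>p \<xi>\<bar> \<le> B * norm \<xi>"
  shows "subexponential p"
  unfolding subexponential_def
proof (intro conjI allI impI exI)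
  fix e :: real and \<xi> :: 'a
  assume "e > 0"
  have "\<bar>p \<xi>\<bar> \<le> \<bar>B\<bar> / e * (e * norm \<xi>)"
    using assms(2) [of \<xi>] \<open>e > 0\<close> mult_right_mono [OF abs_ge_self [of B] norm_ge_zero [of \<xi>]]
    by simp
  also have "\<dots> \<le> \<bar>B\<bar> / e * exp (e * norm \<xi>)"
    using \<open>e > 0\<close> exp_ge_add_one_self [of "e * norm \<xi>"]
    by (intro mult_left_mono) (linarith, simp)
  finally show "\<bar>p \<xi>\<bar> \<le> \<bar>B\<bar> / e * exp (e * norm \<xi>)" .
qed (rule assms)

lemma subexponential_inner: "subexponential (\<lambda>\<xi>. v \<bullet> \<xi>)"
  by (rule subexponential_linear_growth [of _ "norm v"]) (auto simp: Cauchy_Schwarz_ineq2)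

lemma subexponential_norm: "subexponential norm"
  by (rule subexponential_linear_growth [of _ 1]) auto

section \<open>The dual cone and weighted Laplace transforms\<close>

definition dual_cone :: "'a::euclidean_space set \<Rightarrow> 'a set" where
  "dual_cone V = {\<xi>. \<forall>x\<in>V. 0 \<le> x \<bullet> \<xi>}"

text \<open>For \<open>p = 1\<close> this is the Koszul-Vinberg characteristic function of the cone;
  products of linear forms as weights give its derivatives up to sign.\<close>

definition laplace :: "'a::euclidean_space set \<Rightarrow> ('a \<Rightarrow> real) \<Rightarrow> 'a \<Rightarrow> real" where
  "laplace V p x = (\<integral>\<xi>. indicator (dual_cone V) \<xi> * (p \<xi> * exp (- (x \<bullet> \<xi>))) \<partial>lborel)"

lemma closed_dual_cone: "closed (dual_cone V)"
proof -
  have "dual_cone V = (\<Inter>x\<in>V. {\<xi>. 0 \<le> x \<bullet> \<xi>})"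
    by (auto simp: dual_cone_def)
  then show ?thesis
    by (auto intro!: closed_Collect_le continuous_intros)
qed

lemma dual_cone_measurable [measurable]: "dual_cone V \<in> sets borel"
  by (rule borel_closed [OF closed_dual_cone])

lemma convex_dual_cone: "convex (dual_cone V)"
  unfolding convex_def dual_cone_def by (auto simp: inner_add_right)

text \<open>Moving \<open>x\<close> by \<open>e\<close> against the direction of
  \<open>\<xi>\<close> stays in \<open>V\<close>, where the pairing with \<open>\<xi>\<close> is
  nonnegative. This is the source of the exponential decay.\<close>

lemma inner_dual_cone_ge_norm:
  assumes "open V" "x \<in> V"
  obtains e where "e > 0" "\<And>\<xi>. \<xi> \<in> dual_cone V \<Longrightarrow> e * norm \<xi> \<le> x \<bullet> \<xi>"
proof -
  obtain e where e: "e > 0" "cball x e \<subseteq> V"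
    using assms open_contains_cball by blast
  have "e * norm \<xi> \<le> x \<bullet> \<xi>" if "\<xi> \<in> dual_cone V" for \<xi>
  proof (cases "\<xi> = 0")
    case False
    have "x - (e / norm \<xi>) *\<^sub>R \<xi> \<in> cball x e"
      using False \<open>e > 0\<close> by (simp add: dist_norm)
    then have "0 \<le> (x - (e / norm \<xi>) *\<^sub>R \<xi>) \<bullet> \<xi>"
      using e that unfolding dual_cone_def by blast
    also have "\<dots> = x \<bullet> \<xi> - e * norm \<xi>"
      using False by (simp add: inner_diff_left power2_norm_eq_inner [symmetric] power2_eq_square)
    finally show ?thesis
      by simp
  qed simp
  with e(1) show ?thesis
    by (rule that)
qed

text \<open>Half of the decay rate pays for the growth of \<open>p\<close>. The rate is a hypothesis
  so that the lemma also serves at perturbed points, with a smaller rate.\<close>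

lemma laplace_integrable_aux:
  assumes "subexponential p" "e > 0" "\<And>\<xi>. \<xi> \<in> dual_cone V \<Longrightarrow> e * norm \<xi> \<le> x \<bullet> \<xi>"
  shows "integrable lborel (\<lambda>\<xi>. indicator (dual_cone V) \<xi> * (p \<xi> * exp (- (x \<bullet> \<xi>))))"
proof -
  obtain C where C: "\<And>\<xi>. \<bar>p \<xi>\<bar> \<le> C * exp (e / 2 * norm \<xi>)"
    using subexponential_bound [OF assms(1), of "e / 2"] \<open>e > 0\<close> by auto
  show ?thesis
  proof (rule Bochner_Integration.integrable_bound)
    show "integrable lborel (\<lambda>\<xi>::'a. C * exp (- (e / 2) * norm \<xi>))"
      using \<open>e > 0\<close> by (intro integrable_mult_right integrable_exp_norm) simp
    show "(\<lambda>\<xi>. indicator (dual_cone V) \<xi> * (p \<xi> * exp (- (x \<bullet> \<xi>)))) \<in> borel_measurable lborel"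
      using assms(1) by measurable
    have "\<bar>indicator (dual_cone V) \<xi> * (p \<xi> * exp (- (x \<bullet> \<xi>)))\<bar> \<le> \<bar>C * exp (- (e / 2) * norm \<xi>)\<bar>"
      for \<xi>
    proof (cases "\<xi> \<in> dual_cone V")
      case True
      have "\<bar>p \<xi> * exp (- (x \<bullet> \<xi>))\<bar> \<le> (C * exp (e / 2 * norm \<xi>)) * exp (- (e * norm \<xi>))"
        unfolding abs_mult using C [of \<xi>] assms(3) [OF True]
        by (intro mult_mono) (auto intro: order_trans [OF abs_ge_zero])
      also have "\<dots> = C * exp (- (e / 2) * norm \<xi>)"
        by (simp add: algebra_simps flip: exp_add)
      finally show ?thesis
        using True by (simp add: order_trans [OF _ abs_ge_self])
    qed simp
    then show "AE \<xi> in lborel. norm (indicator (dual_cone V) \<xi> * (p \<xi> * exp (- (x \<bullet> \<xi>))))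
        \<le> norm (C * exp (- (e / 2) * norm \<xi>))"
      by simp
  qed
qed

lemma laplace_integrable:
  assumes "open V" "x \<in> V" "subexponential p"
  shows "integrable lborel (\<lambda>\<xi>. indicator (dual_cone V) \<xi> * (p \<xi> * exp (- (x \<bullet> \<xi>))))"
  by (metis assms inner_dual_cone_ge_norm laplace_integrable_aux)

lemma laplace_linear:
  assumes "open V" "x \<in> V" "subexponential p"
  shows "linear (\<lambda>v. laplace V (\<lambda>\<xi>. v \<bullet> \<xi> * p \<xi>) x)"
proof (rule linearI)
  have i: "integrable lborel
      (\<lambda>\<xi>. indicator (dual_cone V) \<xi> * (v \<bullet> \<xi> * p \<xi> * exp (- (x \<bullet> \<xi>))))" for v
    by (intro laplace_integrable assms subexponential_mult subexponential_inner)
  show "laplace V (\<lambda>\<xi>. (u + v) \<bullet> \<xi> * p \<xi>) x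
      = laplace V (\<lambda>\<xi>. u \<bullet> \<xi> * p \<xi>) x + laplace V (\<lambda>\<xi>. v \<bullet> \<xi> * p \<xi>) x" for u v
    unfolding laplace_def
    by (subst Bochner_Integration.integral_add [OF i i, symmetric])
      (simp add: inner_add_left algebra_simps)
  show "laplace V (\<lambda>\<xi>. (c *\<^sub>R v) \<bullet> \<xi> * p \<xi>) x = c *\<^sub>R laplace V (\<lambda>\<xi>. v \<bullet> \<xi> * p \<xi>) x" for c v
    unfolding laplace_def by (simp add: mult.assoc mult.left_commute [of _ c])
qed

text \<open>Differentiation under the integral sign: for all small \<open>h\<close>, the first-order
  remainder of the integrand is at most \<open>(norm h)\<^sup>2\<close> times one fixed integrable
  function.\<close>

lemma laplace_has_derivative:
  fixes V :: "'a::euclidean_space set"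
  assumes "open V" "x \<in> V" "subexponential p"
  shows "(laplace V p has_derivative (\<lambda>h. - laplace V (\<lambda>\<xi>. h \<bullet> \<xi> * p \<xi>) x)) (at x)"
proof -
  obtain e where e: "e > 0" "\<And>\<xi>. \<xi> \<in> dual_cone V \<Longrightarrow> e * norm \<xi> \<le> x \<bullet> \<xi>"
    using inner_dual_cone_ge_norm [OF assms(1,2)] by blast
  have q: "subexponential (\<lambda>\<xi>. p \<xi> * (norm \<xi> * norm \<xi>))"
    by (intro subexponential_mult subexponential_norm assms(3))
  \<comment> \<open>Rate budget: of the decay \<open>e\<close> at \<open>x\<close>, the remainder
    estimate spends \<open>e / 2\<close> and the weight \<open>e / 4\<close>, which leaves the rate
    \<open>e / 4\<close> in \<open>M\<close>.\<close>
  obtain C where C: "\<And>\<xi>. \<bar>p \<xi> * (norm \<xi> * norm \<xi>)\<bar> \<le> C * exp (e / 4 * norm \<xi>)"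
    using subexponential_bound [OF q, of "e / 4"] \<open>e > 0\<close> by auto
  define M where "M = (\<integral>\<xi>. C * exp (- (e / 4) * norm (\<xi>::'a)) \<partial>lborel)"
  have iM: "integrable lborel (\<lambda>\<xi>::'a. C * exp (- (e / 4) * norm \<xi>))"
    using \<open>e > 0\<close> by (intro integrable_mult_right integrable_exp_norm) simp
  have lin: "linear (\<lambda>h. - laplace V (\<lambda>\<xi>. h \<bullet> \<xi> * p \<xi>) x)"
    by (intro linear_compose_neg laplace_linear assms)
  have bound: "\<bar>laplace V p y - laplace V p x - (- laplace V (\<lambda>\<xi>. (y - x) \<bullet> \<xi> * p \<xi>) x)\<bar>
      \<le> (norm (y - x))\<^sup>2 * M" if "dist y x < e / 2" for y
  proof -
    define h where "h = y - x"
    have y: "y = x + h" and h: "norm h \<le> e / 2"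
      using that by (auto simp: h_def dist_norm)
    have hn: "\<bar>h \<bullet> \<xi>\<bar> \<le> e / 2 * norm \<xi>" for \<xi>
      using Cauchy_Schwarz_ineq2 [of h \<xi>] mult_right_mono [OF h norm_ge_zero [of \<xi>]] by linarith
    \<comment> \<open>A small shift keeps half of the decay rate, enough for integrability at
      \<open>y\<close>.\<close>
    have "e / 2 * norm \<xi> \<le> y \<bullet> \<xi>" if "\<xi> \<in> dual_cone V" for \<xi>
      using e(2) [OF that] hn [of \<xi>] by (simp add: y inner_add_left)
    then have iy: "integrable lborel (\<lambda>\<xi>. indicator (dual_cone V) \<xi> * (p \<xi> * exp (- (y \<bullet> \<xi>))))"
      using \<open>e > 0\<close> by (intro laplace_integrable_aux [of p "e / 2"] assms(3)) auto
    have ix: "integrable lborel (\<lambda>\<xi>. indicator (dual_cone V) \<xi> * (p \<xi> * exp (- (x \<bullet> \<xi>))))"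
      by (intro laplace_integrable assms)
    have ih: "integrable lborel
        (\<lambda>\<xi>. indicator (dual_cone V) \<xi> * (h \<bullet> \<xi> * p \<xi> * exp (- (x \<bullet> \<xi>))))"
      by (intro laplace_integrable subexponential_mult subexponential_inner assms)
    let ?r = "\<lambda>\<xi>. indicator (dual_cone V) \<xi> * (p \<xi> * exp (- (y \<bullet> \<xi>)))
      - indicator (dual_cone V) \<xi> * (p \<xi> * exp (- (x \<bullet> \<xi>)))
      + indicator (dual_cone V) \<xi> * (h \<bullet> \<xi> * p \<xi> * exp (- (x \<bullet> \<xi>)))"
    have eq: "laplace V p y - laplace V p x - (- laplace V (\<lambda>\<xi>. h \<bullet> \<xi> * p \<xi>) x)
        = (\<integral>\<xi>. ?r \<xi> \<partial>lborel)"
      unfolding laplace_def using ix iy ih by simp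
    have r: "\<bar>?r \<xi>\<bar> \<le> (norm h)\<^sup>2 * (C * exp (- (e / 4) * norm \<xi>))" for \<xi>
    proof (cases "\<xi> \<in> dual_cone V")
      case True
      \<comment> \<open>The exponent changes by \<open>t\<close> from \<open>x\<close> to
        \<open>y\<close>, so \<open>exp t - 1 - t\<close> is the relative remainder.\<close>
      define t where "t = - (h \<bullet> \<xi>)"
      have t: "\<bar>t\<bar> \<le> e / 2 * norm \<xi>" "\<bar>t\<bar> \<le> norm h * norm \<xi>"
        using hn [of \<xi>] Cauchy_Schwarz_ineq2 [of h \<xi>] by (auto simp: t_def)
      have "?r \<xi> = p \<xi> * exp (- (x \<bullet> \<xi>)) * (exp t - 1 - t)"
        using True by (simp add: y t_def inner_add_left exp_diff exp_minus field_simps)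
      also have "\<bar>\<dots>\<bar> \<le> \<bar>p \<xi> * exp (- (x \<bullet> \<xi>))\<bar> * (t\<^sup>2 * exp \<bar>t\<bar>)"
        unfolding abs_mult by (intro mult_left_mono abs_exp_minus_le) simp
      also have "\<dots> \<le> (\<bar>p \<xi>\<bar> * exp (- (e * norm \<xi>)))
          * ((norm h * norm \<xi>)\<^sup>2 * exp (e / 2 * norm \<xi>))"
        unfolding abs_mult using e(2) [OF True] t
        by (intro mult_mono) (auto simp: abs_le_square_iff [symmetric])
      also have "\<dots> = (norm h)\<^sup>2 * (\<bar>p \<xi> * (norm \<xi> * norm \<xi>)\<bar> * exp (- (e / 2) * norm \<xi>))"
        by (simp add: power2_eq_square abs_mult algebra_simps flip: exp_add)
      also have "\<dots> \<le> (norm h)\<^sup>2 * ((C * exp (e / 4 * norm \<xi>)) * exp (- (e / 2) * norm \<xi>))"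
        by (intro mult_left_mono mult_right_mono C) auto
      also have "\<dots> = (norm h)\<^sup>2 * (C * exp (- (e / 4) * norm \<xi>))"
        by (simp add: algebra_simps flip: exp_add)
      finally show ?thesis .
    next
      case False
      \<comment> \<open>The remainder vanishes here; the bound then needs \<open>C\<close>
        nonnegative, which its defining estimate forces.\<close>
      have "0 \<le> C * exp (e / 4 * norm \<xi>)"
        using C [of \<xi>] by (rule order_trans [OF abs_ge_zero])
      then have "0 \<le> C"
        by (simp add: zero_le_mult_iff)
      with False show ?thesis
        by simp
    qed
    have "\<bar>\<integral>\<xi>. ?r \<xi> \<partial>lborel\<bar> 
        \<le> (\<integral>\<xi>. (norm h)\<^sup>2 * (C * exp (- (e / 4) * norm (\<xi>::'a))) \<partial>lborel)"
      unfolding real_norm_def [symmetric]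
      by (rule Bochner_Integration.integral_norm_bound_integral)
        (use ix iy ih iM r in auto)
    also have "\<dots> = (norm h)\<^sup>2 * M"
      by (simp add: M_def)
    finally show ?thesis
      using eq by (simp add: h_def)
  qed
  show ?thesis
  proof (rule has_derivativeI_sandwich [of "e / 2"])
    show "bounded_linear (\<lambda>h. - laplace V (\<lambda>\<xi>. h \<bullet> \<xi> * p \<xi>) x)"
      using lin by (simp add: linear_conv_bounded_linear)
    show "((\<lambda>y. norm (y - x) * M) \<longlongrightarrow> 0) (at x)"
      by (auto intro!: tendsto_eq_intros)
    show "norm (laplace V p y - laplace V p x - (- laplace V (\<lambda>\<xi>. (y - x) \<bullet> \<xi> * p \<xi>) x))
        / norm (y - x) \<le> norm (y - x) * M" if "y \<noteq> x" "dist y x < e / 2" for y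
      using bound [OF that(2)] that(1) by (simp add: divide_le_eq power2_eq_square mult_ac)
  qed (use \<open>e > 0\<close> in auto)
qed

lemma laplace_comp_linear_has_derivative:
  fixes R :: "'b::euclidean_space \<Rightarrow> 'a::euclidean_space"
  assumes "open V" "linear R" "R z \<in> V" "subexponential p"
  shows "((\<lambda>z. laplace V p (R z)) has_derivative
    (\<lambda>v. - laplace V (\<lambda>\<xi>. R v \<bullet> \<xi> * p \<xi>) (R z))) (at z)"
  using has_derivative_compose [OF linear_imp_has_derivative [OF assms(2)]
      laplace_has_derivative [OF assms(1,3,4)]] by simp

lemma open_vimage_linear:
  fixes R :: "'b::euclidean_space \<Rightarrow> 'a::euclidean_space"
  assumes "open V" "linear R"
  shows "open (R -` V)"
  using assms by (intro open_vimage linear_continuous_on) (auto simp: linear_conv_bounded_linear)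

text \<open>Each directional derivative is again such a transform, with the weight multiplied by a
  linear form and the sign changed; hence the induction over all weights \<open>p\<close>.\<close>

lemma smooth_on_laplace:
  fixes R :: "'b::euclidean_space \<Rightarrow> 'a::euclidean_space"
  assumes "open V" "linear R" "subexponential p"
  shows "smooth_on (R -` V) (\<lambda>z. laplace V p (R z))"
  unfolding smooth_on_def
proof
  note d = laplace_comp_linear_has_derivative [OF assms(1,2)]
  note oR = open_vimage_linear [OF assms(1,2)]
  show "Ck_on k (R -` V) (\<lambda>z. laplace V p (R z))" for k
    using assms(3)
  proof (induction k arbitrary: p)
    case 0
    then show ?case
      using has_derivative_continuous [OF d [OF _ 0]]
      by (auto intro!: continuous_at_imp_continuous_on)
  next
    case (Suc k)
    show ?case
      by (rule Ck_on_SucI [OF oR d [OF _ Suc.prems]])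
        (auto intro!: Ck_on_uminus [OF oR] Suc.IH subexponential_mult subexponential_inner Suc.prems)
  qed
qed

section \<open>Linear changes of variables\<close>

lemma nn_integral_lborel_shift:
  fixes f :: "'a::euclidean_space \<Rightarrow> ennreal"
  assumes "f \<in> borel_measurable borel"
  shows "(\<integral>\<^sup>+x. f (x + a) \<partial>lborel) = (\<integral>\<^sup>+x. f x \<partial>lborel)"
proof -
  have "(\<integral>\<^sup>+x. f x \<partial>lborel) = (\<integral>\<^sup>+x. f x \<partial>distr lborel borel ((+) a))"
    by (simp add: lborel_distr_plus)
  also have "\<dots> = (\<integral>\<^sup>+x. f (a + x) \<partial>lborel)"
    using assms by (intro nn_integral_distr) auto
  finally show ?thesis
    by (simp add: add.commute)
qed

lemma borel_measurable_linear:
  fixes L :: "'a::euclidean_space \<Rightarrow> 'b::euclidean_space"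
  assumes "linear L"
  shows "L \<in> borel_measurable borel"
  using assms by (intro borel_measurable_continuous_onI linear_continuous_on)
    (simp add: linear_conv_bounded_linear)

lemma emeasure_lborel_open_pos:
  fixes S :: "'a::euclidean_space set"
  assumes "open S" "S \<noteq> {}"
  shows "emeasure lborel S > 0"
proof -
  have "S \<notin> null_sets lborel"
    using open_not_negligible [OF assms] null_sets_completionI
    unfolding negligible_iff_null_sets by blast
  then show ?thesis
    using assms(1) by (simp add: null_sets_def zero_less_iff_neq_zero)
qed

text \<open>The library's determinant formula is only available for well-ordered index types. Uniqueness
  of the translation-invariant measure suffices here: with \<open>B\<close> the unit ball, two applications of
  Fubini compare \<open>\<integral>1\<^sub>B \<cdot> \<integral>f \<circ> L\<close> with \<open>\<integral>f \<cdot> \<integral>1\<^sub>B \<circ> L\<close>.\<close>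

lemma distr_lborel_linear:
  fixes L :: "'a::euclidean_space \<Rightarrow> 'a"
  assumes "linear L" "bij L"
  obtains c where "c > 0" "distr lborel borel L = density lborel (\<lambda>_. ennreal c)"
proof -
  define J where "J = inv_into UNIV L"
  have LJ: "L (J y) = y" for y
    by (simp add: J_def surj_f_inv_f [OF bij_is_surj [OF assms(2)]])
  have linJ: "linear J"
    unfolding J_def by (rule inj_linear_imp_inv_linear [OF assms(1) bij_is_inj [OF assms(2)]])
  have [measurable]: "L \<in> borel_measurable borel"
    by (rule borel_measurable_linear [OF assms(1)])
  define g :: "'a \<Rightarrow> ennreal" where "g = indicator (ball 0 1)"
  have [measurable]: "g \<in> borel_measurable borel"
    unfolding g_def by (rule borel_measurable_indicator) simp
  have L_add: "L (x + y) = L x + L y" for x y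
    by (rule linear_add [OF assms(1)])
  define c1 where "c1 = (\<integral>\<^sup>+y. g y \<partial>lborel)"
  \<comment> \<open>The sign appears because \<open>g (y - L x)\<close> becomes
    \<open>g (- L x)\<close> when \<open>x\<close> is shifted by \<open>J y\<close>.\<close>
  define c2 where "c2 = (\<integral>\<^sup>+x. g (- L x) \<partial>lborel)"
  have main: "c1 * (\<integral>\<^sup>+x. f (L x) \<partial>lborel) = c2 * (\<integral>\<^sup>+x. f x \<partial>lborel)"
    if [measurable]: "f \<in> borel_measurable borel" for f :: "'a \<Rightarrow> ennreal"
  proof -
    have "c1 * (\<integral>\<^sup>+x. f (L x) \<partial>lborel) = (\<integral>\<^sup>+y. g y * (\<integral>\<^sup>+x. f (L x) \<partial>lborel) \<partial>lborel)"
      unfolding c1_def by (rule nn_integral_multc [symmetric]) simp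
    also have "\<dots> = (\<integral>\<^sup>+y. \<integral>\<^sup>+x. g y * f (L x + y) \<partial>lborel \<partial>lborel)"
    proof (rule nn_integral_cong)
      fix y
      \<comment> \<open>Shifting \<open>x\<close> by \<open>J y\<close> adds exactly
        \<open>y\<close> to \<open>L x\<close>.\<close>
      have "(\<integral>\<^sup>+x. f (L x) \<partial>lborel) = (\<integral>\<^sup>+x. f (L (x + J y)) \<partial>lborel)"
        by (rule nn_integral_lborel_shift [symmetric]) simp
      then show "g y * (\<integral>\<^sup>+x. f (L x) \<partial>lborel) = (\<integral>\<^sup>+x. g y * f (L x + y) \<partial>lborel)"
        by (simp add: L_add LJ nn_integral_cmult)
    qed
    also have "\<dots> = (\<integral>\<^sup>+x. \<integral>\<^sup>+y. g y * f (L x + y) \<partial>lborel \<partial>lborel)"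
      by (rule lborel_pair.Fubini') simp
    also have "\<dots> = (\<integral>\<^sup>+x. \<integral>\<^sup>+y. g (y - L x) * f y \<partial>lborel \<partial>lborel)"
    proof (rule nn_integral_cong)
      show "(\<integral>\<^sup>+y. g y * f (L x + y) \<partial>lborel) = (\<integral>\<^sup>+y. g (y - L x) * f y \<partial>lborel)" for x
        using nn_integral_lborel_shift [of "\<lambda>y. g (y - L x) * f y" "L x"] by (simp add: add.commute)
    qed
    also have "\<dots> = (\<integral>\<^sup>+y. \<integral>\<^sup>+x. g (y - L x) * f y \<partial>lborel \<partial>lborel)"
      by (rule lborel_pair.Fubini' [symmetric]) simp
    also have "\<dots> = (\<integral>\<^sup>+y. c2 * f y \<partial>lborel)"
    proof (rule nn_integral_cong)
      fix y
      have "(\<integral>\<^sup>+x. g (y - L x) \<partial>lborel) = (\<integral>\<^sup>+x. g (y - L (x + J y)) \<partial>lborel)"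
        by (rule nn_integral_lborel_shift [symmetric]) simp
      then show "(\<integral>\<^sup>+x. g (y - L x) * f y \<partial>lborel) = c2 * f y"
        by (simp add: L_add LJ c2_def nn_integral_multc)
    qed
    also have "\<dots> = c2 * (\<integral>\<^sup>+x. f x \<partial>lborel)"
      by (rule nn_integral_cmult) simp
    finally show ?thesis .
  qed
  have c1: "c1 = emeasure lborel (ball (0::'a) 1)"
    by (simp add: c1_def g_def)
  define S where "S = (\<lambda>x. - L x) -` ball 0 1"
  have "open S"
    unfolding S_def using assms(1)
    by (intro open_vimage continuous_intros linear_continuous_on)
      (auto simp: linear_conv_bounded_linear)
  have c2: "c2 = emeasure lborel S"
  proof -
    have [measurable]: "S \<in> sets borel"
      using \<open>open S\<close> by (rule borel_open)
    have "g (- L x) = indicator S x" for x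
      by (simp add: g_def S_def indicator_def)
    then show ?thesis
      by (simp add: c2_def)
  qed
  have "0 \<in> S"
    using linear_0 [OF assms(1)] by (simp add: S_def)
  then have "c2 > 0"
    using \<open>open S\<close> unfolding c2 by (intro emeasure_lborel_open_pos) auto
  \<comment> \<open>The preimage \<open>S\<close> lies in the image of the unit ball under
    \<open>J\<close>, so \<open>c2\<close> is finite. With both constants positive and finite, the
    identity \<open>main\<close> can be divided by \<open>c1\<close>.\<close>
  moreover have "S \<subseteq> J ` ball 0 1"
  proof
    fix x
    assume "x \<in> S"
    then have "L x \<in> ball 0 1"
      by (simp add: S_def)
    moreover have "x = J (L x)"
      using assms(2) by (simp add: J_def bij_is_inj)
    ultimately show "x \<in> J ` ball 0 1"
      by blast
  qed
  then have "bounded S"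
    using linJ bounded_linear_image [of "ball 0 1" J] bounded_subset
    by (auto simp: linear_conv_bounded_linear)
  then have "c2 < \<infinity>"
    unfolding c2 by (rule emeasure_bounded_finite)
  moreover have "c1 > 0"
    unfolding c1 by (rule emeasure_lborel_open_pos) auto
  moreover have "c1 < \<infinity>"
    unfolding c1 by (rule emeasure_bounded_finite) simp
  ultimately obtain r1 r2 where r: "c1 = ennreal r1" "c2 = ennreal r2" "r1 > 0" "r2 > 0"
    by (cases c1; cases c2) auto
  have "distr lborel borel L = density lborel (\<lambda>_. ennreal (r2 / r1))"
  proof (rule measure_eqI)
    fix A
    assume "A \<in> sets (distr lborel borel L)"
    then have [measurable]: "A \<in> sets borel"
      by simp
    have "emeasure (distr lborel borel L) A = (\<integral>\<^sup>+x. indicator A x \<partial>distr lborel borel L)"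
      by simp
    also have "\<dots> = (\<integral>\<^sup>+x. indicator A (L x) \<partial>lborel)"
      by (rule nn_integral_distr) auto
    finally have *: "ennreal r1 * emeasure (distr lborel borel L) A = ennreal r2 * emeasure lborel A"
      using main [of "indicator A"] by (simp add: r)
    have "emeasure (distr lborel borel L) A
        = ennreal (1 / r1) * (ennreal r1 * emeasure (distr lborel borel L) A)"
      using r by (simp add: mult.assoc [symmetric] flip: ennreal_mult)
    also have "\<dots> = ennreal (r2 / r1) * emeasure lborel A"
      unfolding * using r by (simp add: mult.assoc [symmetric] flip: ennreal_mult)
    also have "\<dots> = emeasure (density lborel (\<lambda>_. ennreal (r2 / r1))) A"
      by (simp add: emeasure_density_const)
    finally show "emeasure (distr lborel borel L) A
        = emeasure (density lborel (\<lambda>_. ennreal (r2 / r1))) A" .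
  qed simp
  then show ?thesis
    using r by (intro that [of "r2 / r1"]) auto
qed

text \<open>One constant serves all integrands; this later makes the potential and its Hessian scale
  alike.\<close>

lemma integral_lborel_linear:
  fixes L :: "'a::euclidean_space \<Rightarrow> 'a"
  assumes "linear L" "bij L"
  obtains c where "c > 0"
    "\<And>f :: 'a \<Rightarrow> real. f \<in> borel_measurable borel
      \<Longrightarrow> (\<integral>x. f (L x) \<partial>lborel) = c * (\<integral>x. f x \<partial>lborel)"
proof -
  obtain c where c: "c > 0" "distr lborel borel L = density lborel (\<lambda>_. ennreal c)"
    using distr_lborel_linear [OF assms] .
  have [measurable]: "L \<in> borel_measurable borel"
    by (rule borel_measurable_linear [OF assms(1)])
  have "(\<integral>x. f (L x) \<partial>lborel) = c * (\<integral>x. f x \<partial>lborel)"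
    if [measurable]: "f \<in> borel_measurable borel" for f :: "'a \<Rightarrow> real"
  proof -
    have "(\<integral>x. f (L x) \<partial>lborel) = (\<integral>x. f x \<partial>distr lborel borel L)"
      by (rule integral_distr [symmetric]) auto
    also have "\<dots> = c * (\<integral>x. f x \<partial>lborel)"
      unfolding c(2) using c(1) by (subst integral_density) auto
    finally show ?thesis .
  qed
  with c(1) show ?thesis
    by (rule that)
qed

section \<open>Relative invariance and positivity of the Laplace transform\<close>

text \<open>Substitute \<open>adjoint A\<close>, which preserves the dual cone and turns the pairing
  of \<open>A x\<close> with \<open>\<xi>\<close> into one with \<open>x\<close>. The factor
  \<open>c\<close> depends on neither \<open>p\<close> nor \<open>x\<close>, so it cancels in
  quotients.\<close>

lemma laplace_linear_image:
  fixes V :: "'a::euclidean_space set"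
  assumes "linear A" "bij A" "A ` V = V"
  obtains c where "c > 0"
    "\<And>p x. p \<in> borel_measurable borel
      \<Longrightarrow> laplace V (\<lambda>\<xi>. p (adjoint A \<xi>)) (A x) = c * laplace V p x"
proof -
  \<comment> \<open>A kernel vector of the adjoint is orthogonal to the range of \<open>A\<close>,
    which is the whole space.\<close>
  have "inj (adjoint A)"
  proof (rule linear_injective_0 [OF adjoint_linear [OF assms(1)], THEN iffD2], intro allI impI)
    fix \<xi>
    assume 0: "adjoint A \<xi> = 0"
    have "A x \<bullet> \<xi> = 0" for x
      using adjoint_works [OF assms(1), of x \<xi>] 0 by simp
    then have "\<xi> \<bullet> \<xi> = 0"
      using bij_is_surj [OF assms(2)] by (metis surj_def)
    then show "\<xi> = 0"
      by simp
  qed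
  then have "bij (adjoint A)"
    using adjoint_linear [OF assms(1)] by (simp add: bij_def linear_injective_imp_surjective)
  then obtain c where c: "c > 0" "\<And>f :: 'a \<Rightarrow> real. f \<in> borel_measurable borel
      \<Longrightarrow> (\<integral>x. f (adjoint A x) \<partial>lborel) = c * (\<integral>x. f x \<partial>lborel)"
    using integral_lborel_linear [OF adjoint_linear [OF assms(1)]] by blast
  have dual: "adjoint A \<xi> \<in> dual_cone V \<longleftrightarrow> \<xi> \<in> dual_cone V" for \<xi>
  proof -
    have "(\<forall>x\<in>A ` V. 0 \<le> x \<bullet> \<xi>) \<longleftrightarrow> (\<forall>x\<in>V. 0 \<le> x \<bullet> \<xi>)"
      by (simp only: assms(3))
    then show ?thesis
      by (simp add: dual_cone_def adjoint_works [OF assms(1)])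
  qed
  have "laplace V (\<lambda>\<xi>. p (adjoint A \<xi>)) (A x) = c * laplace V p x"
    if [measurable]: "p \<in> borel_measurable borel" for p x
  proof -
    have "laplace V (\<lambda>\<xi>. p (adjoint A \<xi>)) (A x)
        = (\<integral>\<xi>. (\<lambda>\<xi>. indicator (dual_cone V) \<xi> * (p \<xi> * exp (- (x \<bullet> \<xi>)))) (adjoint A \<xi>) \<partial>lborel)"
      unfolding laplace_def by (simp add: adjoint_works [OF assms(1)] indicator_def dual)
    also have "\<dots> = c * laplace V p x"
      unfolding laplace_def by (rule c(2)) measurable
    finally show ?thesis .
  qed
  with c(1) show ?thesis
    by (rule that)
qed

text \<open>A vanishing integral of a nonnegative integrand would force \<open>p\<close> to vanish
  almost everywhere on the dual cone, whose interior is open and nonempty, hence not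
  negligible.\<close>

lemma laplace_pos:
  fixes V :: "'a::euclidean_space set"
  assumes "open V" "x \<in> V" "interior (dual_cone V) \<noteq> {}" "subexponential p"
    and "\<And>\<xi>. 0 \<le> p \<xi>" "negligible {\<xi>. p \<xi> = 0}"
  shows "0 < laplace V p x"
proof (rule ccontr)
  assume "\<not> 0 < laplace V p x"
  moreover have "0 \<le> laplace V p x"
    unfolding laplace_def by (intro integral_nonneg_AE) (simp add: assms(5))
  ultimately have "laplace V p x = 0"
    by simp
  then have "AE \<xi> in lborel. indicator (dual_cone V) \<xi> * (p \<xi> * exp (- (x \<bullet> \<xi>))) = 0"
    unfolding laplace_def
    by (subst (asm) integral_nonneg_eq_0_iff_AE [OF laplace_integrable [OF assms(1,2,4)]])
      (simp_all add: assms(5))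
  moreover have "AE \<xi> in lebesgue. p \<xi> \<noteq> 0"
    using assms(6) by (intro AE_I' [of "{\<xi>. p \<xi> = 0}"]) (auto simp: negligible_iff_null_sets)
  \<comment> \<open>\<open>negligible\<close> refers to Lebesgue measure, so the statement over
    \<open>lborel\<close> is passed to the completion.\<close>
  ultimately have "AE \<xi> in lebesgue. \<xi> \<notin> interior (dual_cone V)"
  proof (elim AE_completion [THEN AE_mp] AE_mp, intro AE_I2 impI notI)
    fix \<xi>
    assume "p \<xi> \<noteq> 0" "\<xi> \<in> interior (dual_cone V)"
      and 0: "indicator (dual_cone V) \<xi> * (p \<xi> * exp (- (x \<bullet> \<xi>))) = 0"
    moreover from this have "\<xi> \<in> dual_cone V"
      using interior_subset by blast
    ultimately show False
      by simp
  qed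
  then have "negligible (interior (dual_cone V))"
    by (simp add: negligible_iff_null_sets AE_iff_null_sets)
  then show False
    using open_not_negligible [OF open_interior assms(3)] by simp
qed

text \<open>Regularity puts some point \<open>p + t *\<^sub>R v\<close> outside \<open>V\<close>.
  The normal \<open>a\<close> of a hyperplane separating it from \<open>V\<close> works: it is
  positive at \<open>p\<close> but not at that point, so it is not orthogonal to
  \<open>v\<close>.\<close>

lemma dual_cone_not_subset_hyperplane:
  fixes V :: "(real ^ 'n) set"
  assumes "open V" "convex V" "regular_cone V" "p \<in> V" "v \<noteq> 0"
  obtains \<xi> where "\<xi> \<in> dual_cone V" "v \<bullet> \<xi> \<noteq> 0"
proof -
  obtain t where t: "p + t *\<^sub>R v \<notin> V"
    using assms(3,5) unfolding regular_cone_def contains_line_def by blast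
  obtain a b where ab: "a \<noteq> 0" "a \<bullet> (p + t *\<^sub>R v) \<le> b" "\<And>x. x \<in> V \<Longrightarrow> b \<le> a \<bullet> x"
    using separating_hyperplane_sets [of "{p + t *\<^sub>R v}" V] assms(2,4) t by auto
  have scale: "b \<le> s * (a \<bullet> x)" if "x \<in> V" "s > 0" for x s
    using ab(3) [of "s *\<^sub>R x"] assms(3) that by (simp add: regular_cone_def is_cone_def)
  have "0 \<le> x \<bullet> a" if "x \<in> V" for x
  proof (rule ccontr)
    assume neg: "\<not> 0 \<le> x \<bullet> a"
    \<comment> \<open>A suitable multiple of \<open>x\<close> would fall below the separating level
      \<open>b\<close>: this \<open>s\<close> gives the value
      \<open>- (\<bar>b\<bar> + 1)\<close>.\<close>
    define s where "s = (\<bar>b\<bar> + 1) / - (a \<bullet> x)"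
    have "s > 0" "s * (a \<bullet> x) = - (\<bar>b\<bar> + 1)"
      using neg by (auto simp: s_def inner_commute field_simps)
    then show False
      using scale [OF that, of s] by linarith
  qed
  then have a: "a \<in> dual_cone V"
    by (simp add: dual_cone_def)
  have "b \<le> 0"
  proof (rule ccontr)
    assume "\<not> b \<le> 0"
    then have "b > 0"
      by simp
    \<comment> \<open>A small multiple of \<open>p\<close> would have value at most
      \<open>b / 2\<close>; the summand 1 keeps the denominator nonzero.\<close>
    define s where "s = b / (2 * (\<bar>a \<bullet> p\<bar> + 1))"
    have "s > 0" "s * (\<bar>a \<bullet> p\<bar> + 1) = b / 2"
      using \<open>b > 0\<close> by (auto simp: s_def field_simps)
    moreover have "s * (a \<bullet> p) \<le> s * (\<bar>a \<bullet> p\<bar> + 1)"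
      using \<open>s > 0\<close> by (intro mult_left_mono) auto
    ultimately show False
      using scale [OF assms(4), of s] \<open>b > 0\<close> by linarith
  qed
  moreover have "a \<bullet> p > 0"
  proof -
    obtain e where e: "e > 0" "\<And>\<xi>. \<xi> \<in> dual_cone V \<Longrightarrow> e * norm \<xi> \<le> p \<bullet> \<xi>"
      using inner_dual_cone_ge_norm [OF assms(1,4)] by blast
    have "0 < e * norm a"
      using e(1) ab(1) by simp
    then show ?thesis
      using e(2) [OF a] by (simp add: inner_commute)
  qed
  ultimately have "v \<bullet> a \<noteq> 0"
    using ab(2) by (auto simp: inner_add_right inner_commute)
  with a show ?thesis
    by (rule that)
qed

text \<open>A convex set with empty interior lies in a hyperplane. As the dual cone contains 0, that
  hyperplane is linear, which \<open>dual_cone_not_subset_hyperplane\<close> excludes.\<close>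

lemma interior_dual_cone_nonempty:
  fixes V :: "(real ^ 'n) set"
  assumes "open V" "convex V" "regular_cone V" "p \<in> V"
  shows "interior (dual_cone V) \<noteq> {}"
proof
  assume "interior (dual_cone V) = {}"
  then obtain a b where ab: "a \<noteq> 0" "dual_cone V \<subseteq> {x. a \<bullet> x = b}"
    using empty_interior_subset_hyperplane [OF convex_dual_cone] by blast
  have "0 \<in> dual_cone V"
    by (simp add: dual_cone_def)
  then have "b = 0"
    using ab(2) by auto
  moreover obtain \<xi> where "\<xi> \<in> dual_cone V" "a \<bullet> \<xi> \<noteq> 0"
    using dual_cone_not_subset_hyperplane [OF assms ab(1)] .
  ultimately show False
    using ab(2) by blast
qed

section \<open>The invariant form on the Siegel domain\<close>

definition vec_Re :: "complex ^ 'n \<Rightarrow> real ^ 'n" where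
  "vec_Re z = (\<chi> i. Re (z $ i))"

definition vec_Im :: "complex ^ 'n \<Rightarrow> real ^ 'n" where
  "vec_Im z = (\<chi> i. Im (z $ i))"

lemma vec_Re_cvec [simp]: "vec_Re (cvec x y) = x"
  and vec_Im_cvec [simp]: "vec_Im (cvec x y) = y"
  and cvec_Re_Im [simp]: "cvec (vec_Re z) (vec_Im z) = z"
  by (simp_all add: vec_Re_def vec_Im_def cvec_def vec_eq_iff)

lemma linear_vec_Re: "linear vec_Re" and linear_vec_Im: "linear vec_Im"
  by (auto intro!: linearI simp: vec_Re_def vec_Im_def vec_eq_iff)

lemma vec_Re_std_complex_structure [simp]: "vec_Re (std_complex_structure v) = - vec_Im v"
  and vec_Im_std_complex_structure [simp]: "vec_Im (std_complex_structure v) = vec_Re v"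
  by (simp_all add: vec_Re_def vec_Im_def std_complex_structure_def vec_eq_iff)

lemma std_complex_structure_cvec: "std_complex_structure (cvec x y) = cvec (- y) x"
  by (simp add: std_complex_structure_def cvec_def vec_eq_iff complex_eq_iff)

lemma cvec_add: "cvec (a + c) (b + d) = cvec a b + cvec c d"
  and cvec_scaleR: "cvec (r *\<^sub>R a) (r *\<^sub>R b) = r *\<^sub>R cvec a b"
  by (simp_all add: cvec_def vec_eq_iff complex_eq_iff)

lemma siegel_domain_eq_vimage: "siegel_domain V = vec_Re -` V"
proof
  show "vec_Re -` V \<subseteq> siegel_domain V"
  proof
    fix z
    assume "z \<in> vec_Re -` V"
    then have "cvec (vec_Re z) (vec_Im z) \<in> siegel_domain V"
      unfolding siegel_domain_def by blast
    then show "z \<in> siegel_domain V"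
      by simp
  qed
qed (auto simp: siegel_domain_def)

text \<open>The Hessian of the potential \<open>laplace V (\<lambda>\<xi>. 1)\<close>, entered by
  its integral formula rather than as a second derivative.\<close>

definition hessian_form :: "(real ^ 'n) set \<Rightarrow> real ^ 'n \<Rightarrow> real ^ 'n \<Rightarrow> real ^ 'n \<Rightarrow> real" where
  "hessian_form V x a b = laplace V (\<lambda>\<xi>. a \<bullet> \<xi> * (b \<bullet> \<xi>)) x"

text \<open>In coordinates this is the sum of \<psi>_jk dx_j wedge dy_k with \<psi>_jk the Hessian,
  that is, 2i \<partial> \<partial>-bar of \<psi>(Re z).\<close>

definition siegel_form :: "(real ^ 'n) set \<Rightarrow> 'n form2" where
  "siegel_form V z u v =
     hessian_form V (vec_Re z) (vec_Re u) (vec_Im v) - hessian_form V (vec_Re z) (vec_Im u) (vec_Re v)"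

lemma hessian_form_commute: "hessian_form V x a b = hessian_form V x b a"
  by (simp add: hessian_form_def mult.commute)

lemma hessian_form_linear:
  assumes "open V" "x \<in> V"
  shows "linear (\<lambda>a. hessian_form V x a b)" "linear (hessian_form V x b)"
proof -
  show *: "linear (\<lambda>a. hessian_form V x a b)"
    unfolding hessian_form_def by (intro laplace_linear assms subexponential_inner)
  then show "linear (hessian_form V x b)"
    by (subst (asm) hessian_form_commute)
qed

text \<open>The weight is the square of \<open>v \<bullet> \<xi>\<close> and vanishes only on a
  hyperplane.\<close>

lemma hessian_form_pos:
  fixes V :: "(real ^ 'n) set"
  assumes "open V" "convex V" "regular_cone V" "x \<in> V" "v \<noteq> 0"
  shows "0 < hessian_form V x v v"
  unfolding hessian_form_def
proof (rule laplace_pos [OF assms(1,4) interior_dual_cone_nonempty [OF assms(1-4)]])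
  show "negligible {\<xi>. v \<bullet> \<xi> * (v \<bullet> \<xi>) = 0}"
    using negligible_hyperplane [of v 0] assms(5) by simp
qed (auto intro: subexponential_mult subexponential_inner)

lemma laplace_1_pos:
  fixes V :: "(real ^ 'n) set"
  assumes "open V" "convex V" "regular_cone V" "x \<in> V"
  shows "0 < laplace V (\<lambda>\<xi>. 1) x"
  by (rule laplace_pos [OF assms(1,4) interior_dual_cone_nonempty [OF assms]])
    (auto intro: subexponential_const)

section \<open>The Kaehler property of the form\<close>

lemma siegel_form_bilinear:
  assumes "open V" "vec_Re z \<in> V"
  shows "bilinear (siegel_form V z)"
  unfolding bilinear_def
proof (intro conjI allI)
  note l = hessian_form_linear [OF assms]
  show "linear (siegel_form V z u)" for u
    unfolding siegel_form_def
    using linear_compose [OF linear_vec_Im l(2)] linear_compose [OF linear_vec_Re l(2)]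
    by (intro linear_compose_sub) (simp_all add: o_def)
  show "linear (\<lambda>u. siegel_form V z u v)" for v
    unfolding siegel_form_def
    using linear_compose [OF linear_vec_Im l(1)] linear_compose [OF linear_vec_Re l(1)]
    by (intro linear_compose_sub) (simp_all add: o_def)
qed

text \<open>The minus sign of the Laplace derivative is absorbed by exchanging the two
  terms.\<close>

lemma siegel_form_has_derivative:
  assumes "open V" "vec_Re z \<in> V"
  shows "((\<lambda>p. siegel_form V p u v) has_derivative
    (\<lambda>w. laplace V (\<lambda>\<xi>. vec_Re w \<bullet> \<xi> * (vec_Im u \<bullet> \<xi> * (vec_Re v \<bullet> \<xi>))) (vec_Re z)
       - laplace V (\<lambda>\<xi>. vec_Re w \<bullet> \<xi> * (vec_Re u \<bullet> \<xi> * (vec_Im v \<bullet> \<xi>))) (vec_Re z))) (at z)"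
proof -
  note d = laplace_comp_linear_has_derivative [OF assms(1) linear_vec_Re assms(2)
      subexponential_mult [OF subexponential_inner subexponential_inner]]
  show ?thesis
    unfolding siegel_form_def hessian_form_def
    by (rule has_derivative_eq_rhs [OF has_derivative_diff [OF d d]]) auto
qed

lemma siegel_form_kaehler:
  fixes V :: "(real ^ 'n) set"
  assumes "open V" "convex V" "regular_cone V"
  shows "kaehler_on (siegel_domain V) (siegel_form V)"
  unfolding kaehler_on_def smooth_2form_on_def siegel_domain_eq_vimage
proof (intro conjI ballI allI impI)
  fix u v :: "complex ^ 'n"
  note oU = open_vimage_linear [OF assms(1) linear_vec_Re]
  have "Ck_on k (vec_Re -` V) (\<lambda>z. hessian_form V (vec_Re z) a b)" for k a b
    using smooth_on_laplace [OF assms(1) linear_vec_Re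
        subexponential_mult [OF subexponential_inner subexponential_inner]]
    unfolding hessian_form_def smooth_on_def by blast
  then show "smooth_on (vec_Re -` V) (\<lambda>z. siegel_form V z u v)"
    unfolding smooth_on_def siegel_form_def diff_conv_add_uminus
    by (intro allI Ck_on_add Ck_on_uminus oU)
next
  fix z u v w :: "complex ^ 'n"
  assume z: "z \<in> vec_Re -` V"
  then have z': "vec_Re z \<in> V"
    by simp
  note l = hessian_form_linear [OF assms(1) z']
  note neg = linear_neg [OF l(1)] linear_neg [OF l(2)]
  show "bilinear (siegel_form V z)"
    by (rule siegel_form_bilinear [OF assms(1) z'])
  show "siegel_form V z v v = 0"
    by (simp add: siegel_form_def hessian_form_commute [of V _ "vec_Re v"])
  \<comment> \<open>In the cyclic sum each weight made of two real parts and one imaginary part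
    occurs twice, with opposite signs.\<close>
  show "ext_deriv2 (siegel_form V) z u v w = 0"
    unfolding ext_deriv2_def
      frechet_derivative_at [OF siegel_form_has_derivative [OF assms(1) z'], symmetric]
    by (simp add: mult_ac)
  show "siegel_form V z (std_complex_structure u) (std_complex_structure v) = siegel_form V z u v"
    by (simp add: siegel_form_def neg)
  assume "u \<noteq> 0"
  \<comment> \<open>The metric on \<open>u\<close> is the Hessian form on \<open>vec_Re u\<close>
    plus that on \<open>vec_Im u\<close>, so one nonzero part suffices.\<close>
  have "vec_Re u \<noteq> 0 \<or> vec_Im u \<noteq> 0"
    using \<open>u \<noteq> 0\<close> by (auto simp: vec_Re_def vec_Im_def vec_eq_iff complex_eq_iff)
  moreover have "0 \<le> hessian_form V (vec_Re z) a a" for a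
    using hessian_form_pos [OF assms z', of a] linear_0 [OF l(1)] by (cases "a = 0") auto
  ultimately have "0 < hessian_form V (vec_Re z) (vec_Re u) (vec_Re u)
      + hessian_form V (vec_Re z) (vec_Im u) (vec_Im u)"
    using hessian_form_pos [OF assms z'] by (metis add_pos_nonneg add_nonneg_pos)
  then show "0 < siegel_form V z u (std_complex_structure u)"
    by (simp add: siegel_form_def neg)
qed

definition conformal_siegel_form :: "(real ^ 'n) set \<Rightarrow> 'n form2" where
  "conformal_siegel_form V z u v = inverse (laplace V (\<lambda>\<xi>. 1) (vec_Re z)) * siegel_form V z u v"

lemma conformal_siegel_form_conformally_kaehler:
  fixes V :: "(real ^ 'n) set"
  assumes "open V" "convex V" "regular_cone V"
  shows "conformally_kaehler_on (siegel_domain V) (conformal_siegel_form V)"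
  unfolding conformally_kaehler_on_def
proof (intro exI conjI ballI allI)
  show "kaehler_on (siegel_domain V) (siegel_form V)"
    by (rule siegel_form_kaehler [OF assms])
  have pos: "0 < laplace V (\<lambda>\<xi>. 1) (vec_Re z)" if "z \<in> siegel_domain V" for z
    using laplace_1_pos [OF assms] that by (simp add: siegel_domain_eq_vimage)
  then show "0 < inverse (laplace V (\<lambda>\<xi>. 1) (vec_Re z))" if "z \<in> siegel_domain V" for z
    using that by simp
  show "smooth_on (siegel_domain V) (\<lambda>z. inverse (laplace V (\<lambda>\<xi>. 1) (vec_Re z)))"
    using smooth_on_laplace [OF assms(1) linear_vec_Re subexponential_const [of 1]]
      open_vimage_linear [OF assms(1) linear_vec_Re] pos
    unfolding smooth_on_def siegel_domain_eq_vimage by (metis Ck_on_inverse less_irrefl)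
qed (rule conformal_siegel_form_def)

text \<open>The form and the potential pick up the same factor \<open>k\<close>, which cancels.
  Values depend on the base point only through its real part, so an arbitrary \<open>y'\<close>
  covers imaginary translations.\<close>

lemma conformal_siegel_form_invariant:
  fixes V :: "(real ^ 'n) set"
  assumes "linear_automorphism V A"
  shows "conformal_siegel_form V (cvec (A x) y') (cvec (A a) (A b)) (cvec (A c) (A d))
    = conformal_siegel_form V (cvec x y) (cvec a b) (cvec c d)"
proof -
  have A: "linear A" "bij A" "A ` V = V"
    using assms by (auto simp: linear_automorphism_def)
  obtain k where k: "k > 0"
    "\<And>p x. p \<in> borel_measurable borel
      \<Longrightarrow> laplace V (\<lambda>\<xi>. p (adjoint A \<xi>)) (A x) = k * laplace V p x"
    using laplace_linear_image [OF A] by blast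
  \<comment> \<open>Since \<open>A a \<bullet> \<xi> = a \<bullet> adjoint A \<xi>\<close>, the
    weight on the left is the one on the right composed with the adjoint.\<close>
  have "hessian_form V (A x) (A a) (A b) = k * hessian_form V x a b" for a b
    using k(2) [of "\<lambda>\<xi>. a \<bullet> \<xi> * (b \<bullet> \<xi>)" x] by (simp add: hessian_form_def adjoint_works [OF A(1)])
  moreover have "laplace V (\<lambda>\<xi>. 1) (A x) = k * laplace V (\<lambda>\<xi>. 1) x"
    using k(2) [of "\<lambda>\<xi>. 1" x] by simp
  ultimately show ?thesis
    using k(1) by (simp add: conformal_siegel_form_def siegel_form_def inverse_eq_divide
        flip: right_diff_distrib)
qed

section \<open>The group of affine automorphisms\<close>

lemma siegel_affineE:
  assumes "F \<in> siegel_affine_automorphisms V"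
  obtains A b where "linear_automorphism V A"
    "\<And>z. F z = cvec (A (vec_Re z)) (A (vec_Im z) + b)"
proof -
  obtain A b where A: "linear_automorphism V A" "\<And>x y. F (cvec x y) = cvec (A x) (A y + b)"
    using assms by (auto simp: siegel_affine_automorphisms_def)
  have "F z = cvec (A (vec_Re z)) (A (vec_Im z) + b)" for z
    using A(2) [of "vec_Re z" "vec_Im z"] by simp
  with A(1) show ?thesis
    by (rule that)
qed

lemma siegel_affineI:
  assumes "linear_automorphism V A" "\<And>x y. F (cvec x y) = cvec (A x) (A y + b)"
  shows "F \<in> siegel_affine_automorphisms V"
  using assms by (auto simp: siegel_affine_automorphisms_def)

lemma siegel_affine_id: "(\<lambda>z. z) \<in> siegel_affine_automorphisms V"
  by (rule siegel_affineI [of _ "\<lambda>x. x" _ 0])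
    (auto simp: linear_automorphism_def linear_ident bij_betw_def)

lemma siegel_affine_comp:
  assumes "F \<in> siegel_affine_automorphisms V" "G \<in> siegel_affine_automorphisms V"
  shows "(\<lambda>z. F (G z)) \<in> siegel_affine_automorphisms V"
proof -
  obtain A b where A: "linear_automorphism V A" "\<And>z. F z = cvec (A (vec_Re z)) (A (vec_Im z) + b)"
    using siegel_affineE [OF assms(1)] by blast
  obtain B c where B: "linear_automorphism V B" "\<And>z. G z = cvec (B (vec_Re z)) (B (vec_Im z) + c)"
    using siegel_affineE [OF assms(2)] by blast
  show ?thesis
  proof (rule siegel_affineI)
    show "linear_automorphism V (A \<circ> B)"
      using A(1) B(1) unfolding linear_automorphism_def
      by (metis bij_comp image_comp linear_compose)
    show "F (G (cvec x y)) = cvec ((A \<circ> B) x) ((A \<circ> B) y + (A c + b))" for x y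
      using A B by (simp add: linear_automorphism_def linear_add add.assoc)
  qed
qed

lemma siegel_affine_inverse:
  assumes "F \<in> siegel_affine_automorphisms V"
  obtains G where "G \<in> siegel_affine_automorphisms V" "\<And>z. G (F z) = z" "\<And>z. F (G z) = z"
proof -
  obtain A b where A: "linear_automorphism V A" "\<And>z. F z = cvec (A (vec_Re z)) (A (vec_Im z) + b)"
    using siegel_affineE [OF assms(1)] by blast
  then have lin: "linear A" and bij: "bij A" and AV: "A ` V = V"
    by (auto simp: linear_automorphism_def)
  define B where "B = inv_into UNIV A"
  have BA: "B (A x) = x" and AB: "A (B x) = x" for x
    using bij by (auto simp: B_def bij_is_inj bij_is_surj surj_f_inv_f)
  have linB: "linear B"
    unfolding B_def by (rule inj_linear_imp_inv_linear [OF lin bij_is_inj [OF bij]])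
  have B: "linear_automorphism V B"
    unfolding linear_automorphism_def
  proof (intro conjI linB)
    show "bij B"
      unfolding B_def by (rule bij_imp_bij_inv [OF bij])
    show "B ` V = V"
      using arg_cong [OF AV, of "image B"] by (simp add: image_image BA)
  qed
  \<comment> \<open>Solving for the argument of \<open>F\<close> gives the linear part
    \<open>B\<close> and the translation \<open>- B b\<close>.\<close>
  define G where "G z = cvec (B (vec_Re z)) (B (vec_Im z) + - B b)" for z
  show ?thesis
  proof (rule that [of G])
    show "G \<in> siegel_affine_automorphisms V"
      by (rule siegel_affineI [OF B, where b = "- B b"]) (simp add: G_def)
    show "G (F z) = z" "F (G z) = z" for z
      by (simp_all add: G_def A(2) linear_add [OF linB] linear_diff [OF lin] AB BA)
  qed
qed

section \<open>The transitive action on the domain\<close>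

lemma siegel_affine_image:
  assumes "F \<in> siegel_affine_automorphisms V" "z \<in> siegel_domain V"
  shows "F z \<in> siegel_domain V"
  using siegel_affineE [OF assms(1)] assms(2)
  unfolding siegel_domain_eq_vimage linear_automorphism_def
  by (metis imageI vec_Re_cvec vimageD vimageI)

lemma siegel_affine_bij_betw:
  assumes "F \<in> siegel_affine_automorphisms V"
  shows "bij_betw F (siegel_domain V) (siegel_domain V)"
proof -
  obtain G where "G \<in> siegel_affine_automorphisms V" "\<And>z. G (F z) = z" "\<And>z. F (G z) = z"
    using siegel_affine_inverse [OF assms] by blast
  then show ?thesis
    using siegel_affine_image assms by (intro bij_betw_byWitness [of _ G]) auto
qed

text \<open>Elements of \<open>BijGroup\<close> are undefined outside the domain; restricting makes
  the automorphisms members of it.\<close>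

definition siegel_affine_group :: "(real ^ 'n) set \<Rightarrow> (complex ^ 'n \<Rightarrow> complex ^ 'n) set" where
  "siegel_affine_group V = (\<lambda>F. restrict F (siegel_domain V)) ` siegel_affine_automorphisms V"

lemma restrict_siegel_affine_Bij:
  "F \<in> siegel_affine_automorphisms V \<Longrightarrow> restrict F (siegel_domain V) \<in> Bij (siegel_domain V)"
  by (simp add: Bij_def bij_betw_restrict_eq siegel_affine_bij_betw)

lemma inv_into_restrict_siegel_affine:
  assumes "F \<in> siegel_affine_automorphisms V"
  obtains G where "G \<in> siegel_affine_automorphisms V"
    "\<And>z. z \<in> siegel_domain V \<Longrightarrow> inv_into (siegel_domain V) (restrict F (siegel_domain V)) z = G z"
proof -
  obtain G where G: "G \<in> siegel_affine_automorphisms V" "\<And>z. G (F z) = z" "\<And>z. F (G z) = z"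
    using siegel_affine_inverse [OF assms] by blast
  show ?thesis
  proof (rule that [OF G(1)])
    fix z
    assume z: "z \<in> siegel_domain V"
    have inj: "inj_on (restrict F (siegel_domain V)) (siegel_domain V)"
      using restrict_siegel_affine_Bij [OF assms] by (simp add: Bij_def bij_betw_def)
    show "inv_into (siegel_domain V) (restrict F (siegel_domain V)) z = G z"
      by (rule inv_into_f_eq [OF inj]) (simp_all add: siegel_affine_image [OF G(1) z] G(3))
  qed
qed

lemma subgroup_siegel_affine_group:
  "subgroup (siegel_affine_group V) (BijGroup (siegel_domain V))"
proof
  let ?U = "siegel_domain V"
  show "siegel_affine_group V \<subseteq> carrier (BijGroup ?U)"
    by (auto simp: siegel_affine_group_def BijGroup_def restrict_siegel_affine_Bij)
  show "\<one>\<^bsub>BijGroup ?U\<^esub> \<in> siegel_affine_group V"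
    unfolding siegel_affine_group_def BijGroup_def
    using siegel_affine_id by (auto intro!: image_eqI)
  show "f \<otimes>\<^bsub>BijGroup ?U\<^esub> g \<in> siegel_affine_group V"
    if fg: "f \<in> siegel_affine_group V" "g \<in> siegel_affine_group V" for f g
  proof -
    obtain F G where F: "F \<in> siegel_affine_automorphisms V" "f = restrict F ?U"
      and G: "G \<in> siegel_affine_automorphisms V" "g = restrict G ?U"
      using fg unfolding siegel_affine_group_def by blast
    have "f \<in> Bij ?U" "g \<in> Bij ?U"
      using F G restrict_siegel_affine_Bij by blast+
    then have "f \<otimes>\<^bsub>BijGroup ?U\<^esub> g = compose ?U f g"
      by (simp add: BijGroup_def)
    \<comment> \<open>\<open>G\<close> keeps points in the domain, so the restriction of
      \<open>F\<close> is invisible inside the composite.\<close>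
    also have "\<dots> = restrict (\<lambda>z. F (G z)) ?U"
      by (auto simp: F(2) G(2) compose_def fun_eq_iff siegel_affine_image [OF G(1)])
    finally have "f \<otimes>\<^bsub>BijGroup ?U\<^esub> g = restrict (\<lambda>z. F (G z)) ?U" .
    then show ?thesis
      using siegel_affine_comp [OF F(1) G(1)] by (auto simp: siegel_affine_group_def)
  qed
  show "inv\<^bsub>BijGroup ?U\<^esub> f \<in> siegel_affine_group V"
    if f: "f \<in> siegel_affine_group V" for f
  proof -
    obtain F where F: "F \<in> siegel_affine_automorphisms V" "f = restrict F ?U"
      using f unfolding siegel_affine_group_def by blast
    obtain G where G: "G \<in> siegel_affine_automorphisms V"
      "\<And>z. z \<in> ?U \<Longrightarrow> inv_into ?U f z = G z"
      by (rule inv_into_restrict_siegel_affine [OF F(1), folded F(2)]) (rule that)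
    have "inv\<^bsub>BijGroup ?U\<^esub> f = restrict G ?U"
      using inv_BijGroup [OF restrict_siegel_affine_Bij [OF F(1)]] G(2)
      by (auto simp: F(2) fun_eq_iff)
    then show ?thesis
      using G(1) by (auto simp: siegel_affine_group_def)
  qed
qed

lemma transitive_siegel_affine_group:
  assumes "homogeneous_siegel_domain V"
  shows "transitive_action (BijGroup (siegel_domain V) \<lparr>carrier := siegel_affine_group V\<rparr>)
    (siegel_domain V) (\<lambda>g. g)"
proof -
  let ?U = "siegel_domain V"
  \<comment> \<open>The full bijection group acts tautologically; the action is then cut down to the
    subgroup.\<close>
  have "group_action (BijGroup ?U) ?U (\<lambda>g. g)"
    by (simp add: group_action_def group_hom_def group_hom_axioms_def hom_def group_BijGroup)
  then have "group_action (BijGroup ?U \<lparr>carrier := siegel_affine_group V\<rparr>) ?U (\<lambda>g. g)"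
    by (rule group_action.induced_action [OF _ subgroup_siegel_affine_group])
  then show ?thesis
  proof (rule transitive_action.intro)
    show "transitive_action_axioms (BijGroup ?U \<lparr>carrier := siegel_affine_group V\<rparr>) ?U (\<lambda>g. g)"
      using assms
      by (auto simp: transitive_action_axioms_def homogeneous_siegel_domain_def siegel_affine_group_def)
  qed
qed

text \<open>Splits off the constant, so that the real-linear part can be read off as the
  derivative.\<close>

lemma siegel_affine_linear_part:
  assumes "F \<in> siegel_affine_automorphisms V"
  obtains A b where "linear_automorphism V A" "linear (\<lambda>z. cvec (A (vec_Re z)) (A (vec_Im z)))"
    "\<And>z. F z = cvec (A (vec_Re z)) (A (vec_Im z)) + cvec 0 b"
proof -
  obtain A b where A: "linear_automorphism V A" "\<And>z. F z = cvec (A (vec_Re z)) (A (vec_Im z) + b)"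
    using siegel_affineE [OF assms] by blast
  then have "linear A"
    by (simp add: linear_automorphism_def)
  then have "linear (\<lambda>z. cvec (A (vec_Re z)) (A (vec_Im z)))"
    by (auto intro!: linearI simp: linear_add [OF linear_vec_Re] linear_add [OF linear_vec_Im]
        linear_cmul [OF linear_vec_Re] linear_cmul [OF linear_vec_Im] linear_add linear_cmul
        cvec_add cvec_scaleR)
  moreover have "F z = cvec (A (vec_Re z)) (A (vec_Im z)) + cvec 0 b" for z
    by (simp add: A(2) flip: cvec_add)
  ultimately show ?thesis
    using A(1) that by blast
qed

lemma siegel_affine_preserves:
  fixes V :: "(real ^ 'n) set"
  assumes "open V" "F \<in> siegel_affine_automorphisms V"
  shows "diffeomorphism_on (siegel_domain V) (restrict F (siegel_domain V))"
    and "preserves_complex_structure_on (siegel_domain V) (restrict F (siegel_domain V))"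
    and "preserves_2form_on (siegel_domain V) (conformal_siegel_form V)
      (restrict F (siegel_domain V))"
proof -
  let ?U = "siegel_domain V"
  have oU: "open ?U"
    unfolding siegel_domain_eq_vimage by (rule open_vimage_linear [OF assms(1) linear_vec_Re])
  \<comment> \<open>Any \<open>G'\<close> agreeing with \<open>G\<close> on the domain is allowed,
    so this covers both the restricted map and its \<open>inv_into\<close>.\<close>
  have smooth: "smooth_on ?U G'"
    if G: "G \<in> siegel_affine_automorphisms V" "\<And>z. z \<in> ?U \<Longrightarrow> G' z = G z" for G G'
  proof -
    obtain A b where "linear_automorphism V A"
      "linear (\<lambda>z. cvec (A (vec_Re z)) (A (vec_Im z)))"
      "\<And>z. G z = cvec (A (vec_Re z)) (A (vec_Im z)) + cvec 0 b"
      by (rule siegel_affine_linear_part [OF G(1)]) (rule that)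
    then show ?thesis
      using G(2) by (intro smooth_on_affine [OF oU]) auto
  qed
  obtain G where "G \<in> siegel_affine_automorphisms V"
    "\<And>z. z \<in> ?U \<Longrightarrow> inv_into ?U (restrict F ?U) z = G z"
    by (rule inv_into_restrict_siegel_affine [OF assms(2)]) (rule that)
  then show "diffeomorphism_on ?U (restrict F ?U)"
    using restrict_siegel_affine_Bij [OF assms(2)] smooth smooth [OF assms(2)]
    by (auto simp: diffeomorphism_on_def Bij_def)
  obtain A b where A: "linear_automorphism V A" "linear (\<lambda>z. cvec (A (vec_Re z)) (A (vec_Im z)))"
      "\<And>z. F z = cvec (A (vec_Re z)) (A (vec_Im z)) + cvec 0 b"
    by (rule siegel_affine_linear_part [OF assms(2)]) (rule that)
  have lin: "linear A"
    using A(1) by (simp add: linear_automorphism_def)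
  \<comment> \<open>Restricting changes \<open>F\<close> only outside the open domain, so the
    derivative there is still the linear part.\<close>
  have d: "frechet_derivative (restrict F ?U) (at z) = (\<lambda>v. cvec (A (vec_Re v)) (A (vec_Im v)))"
    if "z \<in> ?U" for z
  proof (rule frechet_derivative_at [symmetric])
    have "(F has_derivative (\<lambda>v. cvec (A (vec_Re v)) (A (vec_Im v)))) (at z)"
      unfolding A(3) [abs_def]
      by (rule has_derivative_eq_rhs [OF has_derivative_add [OF
              linear_imp_has_derivative [OF A(2)] has_derivative_const]]) simp
    then show "(restrict F ?U has_derivative (\<lambda>v. cvec (A (vec_Re v)) (A (vec_Im v)))) (at z)"
      by (rule has_derivative_transform_within_open [OF _ oU that]) simp
  qed
  \<comment> \<open>The derivative applies the same real map \<open>A\<close> to both parts, hence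
    commutes with multiplication by i.\<close>
  show "preserves_complex_structure_on ?U (restrict F ?U)"
    by (simp add: preserves_complex_structure_on_def d std_complex_structure_cvec linear_neg [OF lin])
  show "preserves_2form_on ?U (conformal_siegel_form V) (restrict F ?U)"
    unfolding preserves_2form_on_def
  proof (intro ballI allI)
    fix z u v
    assume z: "z \<in> ?U"
    have "F z = cvec (A (vec_Re z)) (A (vec_Im z) + b)"
      by (simp add: A(3) flip: cvec_add)
    then show "conformal_siegel_form V (restrict F ?U z)
        (frechet_derivative (restrict F ?U) (at z) u) (frechet_derivative (restrict F ?U) (at z) v)
        = conformal_siegel_form V z u v"
      using conformal_siegel_form_invariant [OF A(1), where x = "vec_Re z" and y = "vec_Im z"
          and a = "vec_Re u" and b = "vec_Im u" and c = "vec_Re v" and d = "vec_Im v"] z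
      by (simp add: d)
  qed
qed

theorem corollary5p4:
  fixes V :: "(real ^ 'n) set"
  assumes "open V" and "convex V" and "regular_cone V"
    and "homogeneous_siegel_domain V"
  shows "\<exists>\<eta>. conformally_kaehler_on (siegel_domain V) \<eta> \<and> homogeneous_on (siegel_domain V) \<eta>"
proof (intro exI conjI)
  show "conformally_kaehler_on (siegel_domain V) (conformal_siegel_form V)"
    by (rule conformal_siegel_form_conformally_kaehler [OF assms(1-3)])
  show "homogeneous_on (siegel_domain V) (conformal_siegel_form V)"
    unfolding homogeneous_on_def
  proof (intro exI conjI ballI)
    \<comment> \<open>The group elements are themselves maps, so the action is the identity.\<close>
    show "transitive_action (BijGroup (siegel_domain V) \<lparr>carrier := siegel_affine_group V\<rparr>)
        (siegel_domain V) (\<lambda>g. g)"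
      by (rule transitive_siegel_affine_group [OF assms(4)])
  qed (auto simp: siegel_affine_group_def siegel_affine_preserves [OF assms(1)])
qed

end
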